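(* There is a constant $C>0$, depending only on the polynomial $P$ (with its fixed point $b$ and the branches of $P^{-1}$ fixed; in particular independent of $w$ and $\sigma$), such that $$|g_{\sigma}(w)|\ge C|a|^{|\mathrm{supp}\,\sigma|}\qquad\text{for all } w\in\mathbb{C}\text{ and all }\sigma\in\Sigma,\ \sigma\ne 0.$$ Moreover, if $d<|a|$, then for every $w\in\mathbb{C}$, every integer $m\ge 1$ and every fixed $z\in\mathbb{C}$, as $N\to\infty$, $$\sum_{|\mathrm{supp}\,\sigma|\ge N}|g_{\sigma}(w)|^{-m}=O\bigl((d|a|^{-m})^N\bigr),\qquad \prod_{|\mathrm{supp}\,\sigma|\ge N}\left|1-\frac{z}{g_{\sigma}(w)}\right|=1+O\bigl(|z|(d|a|^{-1})^N\bigr),$$ where the sum and product are over $\sigma\in\Sigma$ with $|\mathrm{supp}\,\sigma|\ge N$.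
   Context: Let $P$ be a complex polynomial of degree $d\ge 2$ and let $b\in\mathbb{C}$, $b\ne 0$, be a repelling fixed point of $P$: $P(b)=b$ and $|a|>1$, where $a:=P'(b)$. Branches of $P^{-1}$: fix functions $P_0^{-1},\dots,P_{d-1}^{-1}:\mathbb{C}\to\mathbb{C}$ such that for every $w\in\mathbb{C}$ the list $P_0^{-1}(w),\dots,P_{d-1}^{-1}(w)$ is the complete list of solutions $z$ of $P(z)=w$, counted with multiplicity. The principal branch $P_0^{-1}$ satisfies $P_0^{-1}(b)=b$ and is analytic in some open neighbourhood of $b$; otherwise the numbering of the branches is arbitrary and no continuity is required. Standing assumption (Hypothesis 1): for every $w\in\mathbb{C}$, the $n$-fold iterate $(P_0^{-1})^{\circ n}(w)\to b$ as $n\to\infty$. $Q$ is the polynomial $Q(z):=\frac{P(z)-b}{z-b}$ (so $Q(b)=a$). With $\mathbb{N}=\{1,2,\dots\}$, $$\Sigma=\{\sigma:\mathbb{N}\to\{0,\dots,d-1\}:\ \lim_{n\to\infty}\sigma_n=0\},$$ i.e. sequences which are eventually $0$; $\sigma=0$ denotes the zero sequence. For $\sigma\in\Sigma$, $\sigma\neq0$, $|\mathrm{supp}\,\sigma|$ denotes the length of the support, i.e. $|\mathrm{supp}\,\sigma|=\max\{n:\ \sigma_n\ne 0\}$. For $w\ne b$ and $\sigma\in\Sigma$, $$g_{\sigma}(w)=(w-b)\prod_{n=1}^{\infty}\frac{a}{Q\bigl(P^{-1}_{\sigma_n}\circ\cdots\circ P^{-1}_{\sigma_1}(w)\bigr)}.$$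 For $w=b$: $g_0(b)=0$, and for $\sigma\ne 0$ with $k=\min\{n:\sigma_n\ne 0\}$, $$g_\sigma(b)=a^k\bigl(P_{\sigma_k}^{-1}(b)-b\bigr)\prod_{n=k+1}^{\infty}\frac{a}{Q\bigl(P^{-1}_{\sigma_n}\circ\cdots\circ P^{-1}_{\sigma_k}(b)\bigr)}.$$ Infinite products over $n$ are limits of partial products. *)

theory Defs
  imports
    "HOL-Complex_Analysis.Complex_Analysis"
    "HOL-Computational_Algebra.Computational_Algebra"
    "HOL-Library.Landau_Symbols"
begin

text \<open>The quotient \<open>(P(z) - b) / (z - b)\<close>. The division is exact when \<open>b\<close> is a fixed point
  of \<open>P\<close>, so \<open>div\<close> also gives the right value at \<open>z = b\<close>.\<close>

definition quot_poly :: "complex poly \<Rightarrow> complex \<Rightarrow> complex poly" where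
  "quot_poly P b = (P - [:b:]) div [:- b, 1:]"

text \<open>Sequences are indexed from 1. Each one is represented by the function on \<open>nat\<close> extending
  it by 0 at index 0, so that distinct functions are distinct sequences.\<close>

definition ev_zero_seqs :: "nat \<Rightarrow> (nat \<Rightarrow> nat) set" where
  "ev_zero_seqs d = {\<sigma>. \<sigma> 0 = 0 \<and> (\<forall>n\<ge>1. \<sigma> n \<in> {0..d - 1}) \<and> \<sigma> \<longlonglongrightarrow> 0}"

text \<open>Only meaningful for a nonzero eventually zero sequence.\<close>

definition supp_len :: "(nat \<Rightarrow> nat) \<Rightarrow> nat" where
  "supp_len \<sigma> = Max {n. \<sigma> n \<noteq> 0}"

definition seqs_supp_ge :: "nat \<Rightarrow> nat \<Rightarrow> (nat \<Rightarrow> nat) set" where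
  "seqs_supp_ge d N = {\<sigma> \<in> ev_zero_seqs d. \<sigma> \<noteq> (\<lambda>_. 0) \<and> N \<le> supp_len \<sigma>}"

text \<open>With \<open>B j\<close> the \<open>j\<close>-th branch of the inverse, \<open>branch_comp B \<sigma> k n\<close> is
  \<open>B (\<sigma> n) \<circ> \<dots> \<circ> B (\<sigma> k)\<close>; the branch with index \<open>\<sigma> k\<close> is applied first.\<close>

definition branch_comp ::
    "(nat \<Rightarrow> complex \<Rightarrow> complex) \<Rightarrow> (nat \<Rightarrow> nat) \<Rightarrow> nat \<Rightarrow> nat \<Rightarrow> complex \<Rightarrow> complex" where
  "branch_comp B \<sigma> k n = fold (\<lambda>i. B (\<sigma> i)) [k..<Suc n]"

text \<open>Infinite products over \<open>n\<close> are plain limits of partial products; unlike in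
  \<open>convergent_prod\<close>, a zero limit is not excluded.\<close>

definition g ::
    "complex poly \<Rightarrow> complex \<Rightarrow> (nat \<Rightarrow> complex \<Rightarrow> complex) \<Rightarrow> (nat \<Rightarrow> nat) \<Rightarrow> complex \<Rightarrow> complex" where
  "g P b B \<sigma> w =
    (let a = poly (pderiv P) b; Q = quot_poly P b in
     if w \<noteq> b then
       (w - b) * lim (\<lambda>M. \<Prod>n=1..M. a / poly Q (branch_comp B \<sigma> 1 n w))
     else if \<sigma> = (\<lambda>_. 0) then 0
     else
       (let k = (LEAST n. \<sigma> n \<noteq> 0) in
        a ^ k * (B (\<sigma> k) b - b) *
          lim (\<lambda>M. \<Prod>n=k+1..M. a / poly Q (branch_comp B \<sigma> k n b))))"

text \<open>Unordered infinite products, in analogy with \<open>has_sum\<close> and \<open>infsum\<close>.\<close>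

definition has_unordered_prod :: "('i \<Rightarrow> real) \<Rightarrow> real \<Rightarrow> 'i set \<Rightarrow> bool" where
  "has_unordered_prod f p A \<longleftrightarrow> (prod f \<longlongrightarrow> p) (finite_subsets_at_top A)"

definition unordered_prod :: "('i \<Rightarrow> real) \<Rightarrow> 'i set \<Rightarrow> real" where
  "unordered_prod f A = Lim (finite_subsets_at_top A) (prod f)"

end

theory Submission
  imports Defs
begin

text \<open>Along the backward orbit \<open>z\<^sub>n\<close> of \<open>w\<close> coded by \<open>\<sigma>\<close> the defining product telescopes, so
  \<open>g\<^sub>\<sigma>(w) = lim a\<^sup>n (z\<^sub>n - b)\<close>. With \<open>L = |supp \<sigma>|\<close> this is \<open>a\<^sup>L \<phi>(z\<^sub>L)\<close>, where \<open>\<phi>\<close> is the Koenigs limit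
  of the principal branch. Since \<open>z\<^sub>L\<close> is a value of a non-principal branch it keeps a fixed distance
  from \<open>b\<close>, and there \<open>|\<phi>|\<close> is bounded below: \<open>\<phi>\<close> is comparable to \<open>|z - b|\<close> near \<open>b\<close>, and the orbit
  enters a small disc around \<open>b\<close> not too close to its centre. The asymptotics follow because at most
  \<open>d\<^sup>L\<close> sequences have support length \<open>L\<close>.\<close>

section \<open>Unordered products of real numbers\<close>

text \<open>Peeling off one factor and using \<open>1 + t \<le> exp t\<close> gives the induction.
  Only the sum of the deviations enters, so the bound survives the passage to infinite
  products.\<close>

lemma abs_prod_minus_one_le:
  fixes h :: "'i \<Rightarrow> real"
  assumes "finite F"
  shows "\<bar>prod h F - 1\<bar> \<le> exp (\<Sum>i\<in>F. \<bar>h i - 1\<bar>) - 1"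
  using assms
proof (induction F rule: finite_induct)
  case (insert x F)
  let ?e = "\<lambda>F. exp (\<Sum>i\<in>F. \<bar>h i - 1\<bar>)"
  have abs_le: "\<bar>prod h F\<bar> \<le> ?e F"
    using insert.IH by linarith
  have "h x * prod h F - 1 = (h x - 1) * prod h F + (prod h F - 1)"
    by (simp add: algebra_simps)
  then have "\<bar>h x * prod h F - 1\<bar> \<le> \<bar>h x - 1\<bar> * \<bar>prod h F\<bar> + \<bar>prod h F - 1\<bar>"
    by (metis abs_mult abs_triangle_ineq)
  also have "\<dots> \<le> \<bar>h x - 1\<bar> * ?e F + (?e F - 1)"
    using insert.IH abs_le by (intro add_mono mult_left_mono) auto
  also have "\<dots> = (1 + \<bar>h x - 1\<bar>) * ?e F - 1"
    by (simp add: algebra_simps)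
  also have "\<dots> \<le> exp \<bar>h x - 1\<bar> * ?e F - 1"
    by (intro diff_right_mono mult_right_mono exp_ge_add_one_self) auto
  finally show ?case
    using insert.hyps by (simp add: exp_add)
qed simp

text \<open>A Markov-type count: \<open>n\<close> such indices contribute at least
  \<open>n * t\<close> to the sum. It isolates the factors of a product that are far from 1.\<close>

lemma finite_summable_on_ge:
  fixes f :: "'i \<Rightarrow> real"
  assumes "f summable_on A" and nonneg: "\<And>i. i \<in> A \<Longrightarrow> 0 \<le> f i" and "t > 0"
  shows "finite {i \<in> A. t \<le> f i}"
proof (rule ccontr)
  assume inf: "infinite {i \<in> A. t \<le> f i}"
  obtain n :: nat where n: "infsum f A < of_nat n * t"
    using \<open>t > 0\<close> ex_less_of_nat_mult by blast
  obtain F where F: "F \<subseteq> {i \<in> A. t \<le> f i}" "finite F" "card F = n"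
    using infinite_arbitrarily_large[OF inf] by blast
  have "of_nat n * t \<le> sum f F"
    using F sum_bounded_below[of F t f] by auto
  also have "\<dots> \<le> infsum f A"
    using F nonneg by (intro finite_sum_le_infsum assms) auto
  finally show False
    using n by simp
qed

text \<open>A zero factor annihilates every finite product containing it; otherwise all factors are
  positive and the product is the exponential of a convergent sum of logarithms.\<close>

lemma has_unordered_prod_exists:
  fixes h :: "'i \<Rightarrow> real"
  assumes summ: "(\<lambda>i. \<bar>h i - 1\<bar>) summable_on A" and nonneg: "\<And>i. i \<in> A \<Longrightarrow> 0 \<le> h i"
  shows "\<exists>p. has_unordered_prod h p A"
proof (cases "\<exists>i\<in>A. h i = 0")
  case True
  then obtain i where i: "i \<in> A" "h i = 0"
    by blast
  have "eventually (\<lambda>F. prod h F = 0) (finite_subsets_at_top A)"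
    unfolding eventually_finite_subsets_at_top
    using i by (intro exI[of _ "{i}"]) (auto intro: prod_zero)
  then show ?thesis
    unfolding has_unordered_prod_def by (blast intro: tendsto_eventually)
next
  case False
  then have pos: "0 < h i" if "i \<in> A" for i
    using nonneg that by (metis less_eq_real_def)
  \<comment> \<open>Off \<open>T\<close> the quadratic estimate for the logarithm applies; the
    finitely many indices in \<open>T\<close> do not affect summability.\<close>
  define T where "T = {i \<in> A. 1 / 2 \<le> \<bar>h i - 1\<bar>}"
  have "finite T"
    unfolding T_def using summ by (intro finite_summable_on_ge) auto
  have "(\<lambda>i. norm (ln (h i))) summable_on (A - T)"
  proof (rule summable_on_comparison_test)
    show "(\<lambda>i. 2 * \<bar>h i - 1\<bar>) summable_on (A - T)"
      using summ \<open>finite T\<close> by (intro summable_on_cmult_right summable_on_cofin_subset)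
    fix i assume "i \<in> A - T"
    then have le: "\<bar>h i - 1\<bar> \<le> 1 / 2"
      by (auto simp: T_def)
    have "\<bar>ln (1 + (h i - 1)) - (h i - 1)\<bar> \<le> 2 * (h i - 1)\<^sup>2"
      using le by (rule abs_ln_one_plus_x_minus_x_bound)
    moreover have "2 * (h i - 1)\<^sup>2 \<le> \<bar>h i - 1\<bar>"
      using mult_right_mono[OF le, of "\<bar>h i - 1\<bar>"] by (simp add: power2_eq_square)
    moreover have "\<bar>ln (h i)\<bar> \<le> \<bar>ln (h i) - (h i - 1)\<bar> + \<bar>h i - 1\<bar>"
      using abs_triangle_ineq[of "ln (h i) - (h i - 1)" "h i - 1"] by simp
    ultimately show "norm (ln (h i)) \<le> 2 * \<bar>h i - 1\<bar>"
      by simp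
  qed auto
  then have "(\<lambda>i. ln (h i)) summable_on (A - T)"
    by (rule abs_summable_summable)
  then have "(\<lambda>i. ln (h i)) summable_on (A - T) \<union> T"
    using \<open>finite T\<close> by (intro summable_on_Un_disjoint) auto
  then have "(\<lambda>i. ln (h i)) summable_on A"
    by (auto simp: T_def Un_absorb2)
  then obtain s where "(sum (\<lambda>i. ln (h i)) \<longlongrightarrow> s) (finite_subsets_at_top A)"
    unfolding summable_on_def has_sum_def by blast
  then have lim: "((\<lambda>F. exp (\<Sum>i\<in>F. ln (h i))) \<longlongrightarrow> exp s) (finite_subsets_at_top A)"
    by (rule tendsto_exp)
  have "eventually (\<lambda>F. exp (\<Sum>i\<in>F. ln (h i)) = prod h F) (finite_subsets_at_top A)"
  proof (rule eventually_finite_subsets_at_top_weakI)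
    fix F assume F: "finite F" "F \<subseteq> A"
    then show "exp (\<Sum>i\<in>F. ln (h i)) = prod h F"
      using pos by (auto simp: exp_sum intro!: prod.cong)
  qed
  with lim show ?thesis
    unfolding has_unordered_prod_def by (blast intro: Lim_transform_eventually)
qed

lemma abs_unordered_prod_minus_one_le:
  fixes h :: "'i \<Rightarrow> real"
  assumes summ: "(\<lambda>i. \<bar>h i - 1\<bar>) summable_on A" and nonneg: "\<And>i. i \<in> A \<Longrightarrow> 0 \<le> h i"
    and le: "(\<Sum>\<^sub>\<infinity>i\<in>A. \<bar>h i - 1\<bar>) \<le> s" and "s \<le> 1"
  shows "\<bar>unordered_prod h A - 1\<bar> \<le> 2 * s"
proof -
  obtain p where p: "(prod h \<longlongrightarrow> p) (finite_subsets_at_top A)"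
    using has_unordered_prod_exists[OF summ nonneg] unfolding has_unordered_prod_def by blast
  have "0 \<le> s"
    using le infsum_nonneg[of A "\<lambda>i. \<bar>h i - 1\<bar>"] by auto
  \<comment> \<open>On the unit interval \<open>exp s \<le> 1 + s + s^2 \<le> 1 + 2 * s\<close>;
    this is the source of the factor 2.\<close>
  then have exp_le: "exp s - 1 \<le> 2 * s"
    using exp_bound[of s] \<open>s \<le> 1\<close> mult_right_mono[of s 1 s] by (simp add: power2_eq_square)
  have "\<bar>prod h F - 1\<bar> \<le> 2 * s" if F: "finite F" "F \<subseteq> A" for F
  proof -
    have "(\<Sum>i\<in>F. \<bar>h i - 1\<bar>) \<le> s"
      using finite_sum_le_infsum[OF summ F] le by auto
    then show ?thesis
      using abs_prod_minus_one_le[OF F(1), of h] exp_le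
      by (smt (verit) exp_le_cancel_iff)
  qed
  then have ev: "eventually (\<lambda>F. \<bar>prod h F - 1\<bar> \<le> 2 * s) (finite_subsets_at_top A)"
    by (intro eventually_finite_subsets_at_top_weakI)
  have "((\<lambda>F. \<bar>prod h F - 1\<bar>) \<longlongrightarrow> \<bar>p - 1\<bar>) (finite_subsets_at_top A)"
    by (intro tendsto_intros p)
  then have "\<bar>p - 1\<bar> \<le> 2 * s"
    using ev by (rule tendsto_upperbound) simp
  moreover have "unordered_prod h A = p"
    unfolding unordered_prod_def using p by (intro tendsto_Lim) auto
  ultimately show ?thesis
    by simp
qed

section \<open>Counting eventually zero sequences\<close>

text \<open>Convergence in the discrete space \<open>nat\<close> means being eventually constant.
  Finiteness gives \<open>Max\<close> in \<open>supp_len\<close> its meaning.\<close>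

lemma finite_support_ev_zero_seqs:
  assumes "\<sigma> \<in> ev_zero_seqs d"
  shows "finite {n. \<sigma> n \<noteq> 0}"
proof -
  have "eventually (\<lambda>n. \<sigma> n = 0) sequentially"
    using assms by (auto simp: ev_zero_seqs_def tendsto_discrete)
  then show ?thesis
    by (simp add: cofinite_eq_sequentially[symmetric] eventually_cofinite)
qed

lemma supp_len_nonzero:
  assumes "\<sigma> \<in> ev_zero_seqs d" and "\<sigma> \<noteq> (\<lambda>_. 0)"
  shows "\<sigma> (supp_len \<sigma>) \<noteq> 0" and "0 < supp_len \<sigma>"
proof -
  have "{n. \<sigma> n \<noteq> 0} \<noteq> {}"
    using assms(2) by auto
  then show nz: "\<sigma> (supp_len \<sigma>) \<noteq> 0"
    unfolding supp_len_def
    using Max_in[OF finite_support_ev_zero_seqs[OF assms(1)]] by blast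
  \<comment> \<open>Index 0 carries the padding value 0, so it cannot be the last nonzero
    index.\<close>
  show "0 < supp_len \<sigma>"
    using nz assms(1) by (metis (mono_tags, lifting) ev_zero_seqs_def mem_Collect_eq gr0I)
qed

lemma eq_zero_beyond_supp_len:
  assumes "\<sigma> \<in> ev_zero_seqs d" and "supp_len \<sigma> < n"
  shows "\<sigma> n = 0"
  using assms Max_ge[OF finite_support_ev_zero_seqs[OF assms(1)], of n]
  unfolding supp_len_def by fastforce

lemma ev_zero_seqs_less:
  assumes "\<sigma> \<in> ev_zero_seqs d" and "0 < d"
  shows "\<sigma> n < d"
  using assms by (cases "n = 0") (auto simp: ev_zero_seqs_def Suc_le_eq less_Suc_eq_le dest!: spec[of _ n])

text \<open>Such a sequence vanishes at index 0 and beyond \<open>L\<close>, so restriction to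
  \<open>{1..L}\<close> is injective.\<close>

lemma card_supp_len_le:
  fixes d :: nat
  assumes "0 < d" and "F \<subseteq> {\<sigma> \<in> ev_zero_seqs d. supp_len \<sigma> = L}"
  shows "card F \<le> d ^ L"
proof -
  have "inj_on (\<lambda>\<sigma>. restrict \<sigma> {1..L}) F"
  proof (rule inj_onI, rule ext)
    fix \<sigma> \<tau> n
    assume in_F: "\<sigma> \<in> F" "\<tau> \<in> F" and eq: "restrict \<sigma> {1..L} = restrict \<tau> {1..L}"
    then have ev: "\<sigma> \<in> ev_zero_seqs d" "\<tau> \<in> ev_zero_seqs d" and len: "supp_len \<sigma> = L" "supp_len \<tau> = L"
      using assms(2) by blast+
    consider "n = 0" | "n \<in> {1..L}" | "L < n"
      by fastforce
    then show "\<sigma> n = \<tau> n"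
    proof cases
      case 1
      then show ?thesis
        using ev by (simp add: ev_zero_seqs_def)
    next
      case 2
      then show ?thesis
        using fun_cong[OF eq, of n] by simp
    next
      case 3
      then have "\<sigma> n = 0" "\<tau> n = 0"
        using ev len by (auto intro: eq_zero_beyond_supp_len)
      then show ?thesis
        by simp
    qed
  qed
  moreover have "(\<lambda>\<sigma>. restrict \<sigma> {1..L}) ` F \<subseteq> {1..L} \<rightarrow>\<^sub>E {..<d}"
  proof (rule image_subsetI)
    fix \<sigma> assume "\<sigma> \<in> F"
    then have "\<sigma> n < d" for n
      using assms ev_zero_seqs_less[of \<sigma> d n] by auto
    then show "restrict \<sigma> {1..L} \<in> {1..L} \<rightarrow>\<^sub>E {..<d}"
      by auto
  qed
  ultimately have "card F \<le> card ({1..L} \<rightarrow>\<^sub>E {..<d})"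
    by (intro card_inj_on_le) (auto intro: finite_PiE)
  then show ?thesis
    by (simp add: card_PiE)
qed

text \<open>Grouping by support length, with at most \<open>d ^ L\<close> sequences of length
  \<open>L\<close>, leaves a geometric tail. The bound is uniform in \<open>F\<close>, as
  summability requires.\<close>

lemma sum_geometric_supp_len_le:
  fixes x :: real
  assumes "0 < d" and "0 \<le> x" and "real d * x < 1"
    and F: "finite F" "F \<subseteq> seqs_supp_ge d N"
  shows "(\<Sum>\<sigma>\<in>F. x ^ supp_len \<sigma>) \<le> (real d * x) ^ N / (1 - real d * x)"
proof -
  let ?q = "real d * x"
  have q: "0 \<le> ?q" "?q < 1"
    using assms by auto
  have sub: "supp_len ` F \<subseteq> {N..}"
    using F by (auto simp: seqs_supp_ge_def)
  then have inj: "inj_on (\<lambda>L. L - N) (supp_len ` F)"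
    by (intro inj_onI) (metis atLeast_iff eq_diff_iff subsetD)
  have "(\<Sum>\<sigma>\<in>F. x ^ supp_len \<sigma>) = (\<Sum>L\<in>supp_len ` F. \<Sum>\<sigma> | \<sigma> \<in> F \<and> supp_len \<sigma> = L. x ^ supp_len \<sigma>)"
    using F by (intro sum.image_gen)
  also have "\<dots> \<le> (\<Sum>L\<in>supp_len ` F. ?q ^ L)"
  proof (rule sum_mono)
    fix L
    have "card {\<sigma> \<in> F. supp_len \<sigma> = L} \<le> d ^ L"
      using F assms(1) by (intro card_supp_len_le) (auto simp: seqs_supp_ge_def)
    then have "real (card {\<sigma> \<in> F. supp_len \<sigma> = L}) * x ^ L \<le> real (d ^ L) * x ^ L"
      using assms(2) by (intro mult_right_mono of_nat_mono) auto
    then show "(\<Sum>\<sigma> | \<sigma> \<in> F \<and> supp_len \<sigma> = L. x ^ supp_len \<sigma>) \<le> ?q ^ L"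
      by (simp add: power_mult_distrib)
  qed
  \<comment> \<open>All lengths are at least \<open>N\<close>, so truncated subtraction loses
    nothing and the shift extracts \<open>?q ^ N\<close>.\<close>
  also have "\<dots> = (\<Sum>k\<in>(\<lambda>L. L - N) ` supp_len ` F. ?q ^ (k + N))"
    unfolding sum.reindex[OF inj] o_def using sub by (intro sum.cong) auto
  also have "\<dots> = ?q ^ N * (\<Sum>k\<in>(\<lambda>L. L - N) ` supp_len ` F. ?q ^ k)"
    by (simp add: power_add sum_distrib_left mult.commute)
  also have "\<dots> \<le> ?q ^ N * (\<Sum>k. ?q ^ k)"
    using F q by (intro mult_left_mono sum_le_suminf summable_geometric) auto
  also have "\<dots> = ?q ^ N / (1 - ?q)"
    using q by (simp add: suminf_geometric)
  finally show ?thesis .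
qed

lemma summable_on_geometric_supp_len:
  fixes x c :: real and f :: "(nat \<Rightarrow> nat) \<Rightarrow> real"
  assumes x: "0 < d" "0 \<le> x" "real d * x < 1" and "0 \<le> c"
    and f: "\<And>\<sigma>. \<sigma> \<in> seqs_supp_ge d N \<Longrightarrow> 0 \<le> f \<sigma> \<and> f \<sigma> \<le> c * x ^ supp_len \<sigma>"
  shows "f summable_on seqs_supp_ge d N"
    and "(\<Sum>\<^sub>\<infinity>\<sigma>\<in>seqs_supp_ge d N. f \<sigma>) \<le> c / (1 - real d * x) * (real d * x) ^ N"
proof -
  have le: "sum f F \<le> c / (1 - real d * x) * (real d * x) ^ N"
    if F: "finite F" "F \<subseteq> seqs_supp_ge d N" for F
  proof -
    have "sum f F \<le> (\<Sum>\<sigma>\<in>F. c * x ^ supp_len \<sigma>)"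
      using F f by (intro sum_mono) auto
    also have "\<dots> = c * (\<Sum>\<sigma>\<in>F. x ^ supp_len \<sigma>)"
      by (simp add: sum_distrib_left)
    also have "\<dots> \<le> c * ((real d * x) ^ N / (1 - real d * x))"
      using \<open>0 \<le> c\<close> by (intro mult_left_mono sum_geometric_supp_len_le x F)
    finally show ?thesis
      by simp
  qed
  show summ: "f summable_on seqs_supp_ge d N"
    using f le by (intro nonneg_bdd_above_summable_on bdd_aboveI) auto
  show "(\<Sum>\<^sub>\<infinity>\<sigma>\<in>seqs_supp_ge d N. f \<sigma>) \<le> c / (1 - real d * x) * (real d * x) ^ N"
    using summ le by (rule infsum_le_finite_sums)
qed

section \<open>The Koenigs limit at a repelling fixed point\<close>

text \<open>The factor theorem makes the division exact. It serves first for \<open>P\<close>,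
  giving \<open>Q\<close>, and then for \<open>Q\<close> itself at \<open>b\<close>.\<close>

lemma linear_factor_mult_div:
  assumes "poly P b = c"
  shows "[:- b, 1:] * ((P - [:c:]) div [:- b, 1:]) = P - [:c:]"
  using assms poly_eq_0_iff_dvd[of "P - [:c:]" b] by (intro dvd_mult_div_cancel) simp

locale repelling_branches =
  fixes P :: "complex poly" and b a :: complex and d :: nat
    and B :: "nat \<Rightarrow> complex \<Rightarrow> complex"
  assumes d_def: "d = degree P" and d_ge: "d \<ge> 2"
    and fixed: "poly P b = b"
    and a_def: "a = poly (pderiv P) b" and norm_a: "norm a > 1"
    and branches: "\<And>w. image_mset (\<lambda>j. B j w) (mset_set {0..d - 1}) = proots (P - [:w:])"
    and B0_fixed: "B 0 b = b"
    and B0_isCont: "isCont (B 0) b"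
    and B0_iterates: "\<And>w. (\<lambda>n. (B 0 ^^ n) w) \<longlonglongrightarrow> b"
begin

abbreviation Q :: "complex poly" where "Q \<equiv> quot_poly P b"

section \<open>Inverse branches as roots with multiplicity, and the quotient
  \<open>Q\<close>\<close>

lemma poly_minus_const_nonzero: "P - [:w:] \<noteq> 0"
  using d_def d_ge by auto

lemma poly_branch:
  assumes "j < d"
  shows "poly P (B j w) = w"
proof -
  have "B j w \<in># image_mset (\<lambda>j. B j w) (mset_set {0..d - 1})"
    using assms by auto
  then show ?thesis
    unfolding branches using poly_minus_const_nonzero by simp
qed

text \<open>The branches list roots with multiplicity, so a value taken by two of them is a multiple
  root of \<open>P - [:w:]\<close>.\<close>

lemma pderiv_eq_0_if_branches_eq:
  assumes "i < d" "j < d" "i \<noteq> j" and eq: "B i w = B j w"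
  shows "poly (pderiv P) (B i w) = 0"
proof -
  let ?p = "P - [:w:]" and ?x = "B i w"
  have "{0..d - 1} = insert i (insert j ({0..d - 1} - {i, j}))"
    using assms by auto
  then have "mset_set {0..d - 1} = add_mset i (add_mset j (mset_set ({0..d - 1} - {i, j})))"
    using assms(3) by (metis (no_types, lifting) Diff_iff finite_Diff finite_atLeastAtMost
        finite_insert insertE insertI1 insert_iff mset_set.insert)
  then have "2 \<le> count (image_mset (\<lambda>j. B j w) (mset_set {0..d - 1})) ?x"
    using eq by simp
  then have "2 \<le> order ?x ?p"
    unfolding branches using poly_minus_const_nonzero by simp
  moreover have "order ?x ?p = Suc (order ?x (pderiv ?p))"
    using poly_minus_const_nonzero poly_branch[OF assms(1)] by (intro order_pderiv) auto
  ultimately have "order ?x (pderiv ?p) \<noteq> 0"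
    by simp
  then show ?thesis
    using order_root[of "pderiv ?p" ?x] by (simp add: pderiv_diff)
qed

lemma Q_eq: "poly P z - b = (z - b) * poly Q z"
proof -
  have "poly ([:- b, 1:] * Q) z = poly (P - [:b:]) z"
    unfolding quot_poly_def using linear_factor_mult_div[OF fixed] by simp
  then show ?thesis
    by (simp add: algebra_simps)
qed

text \<open>Differentiate the factorisation of \<open>P - [:b:]\<close> at \<open>b\<close>.\<close>

lemma Q_at_b: "poly Q b = a"
proof -
  have "pderiv P = pderiv ([:- b, 1:] * Q)"
    unfolding quot_poly_def linear_factor_mult_div[OF fixed] by (simp add: pderiv_diff)
  then show ?thesis
    unfolding a_def by (simp add: pderiv_mult pderiv_pCons del: mult_pCons_left)
qed

text \<open>One backward step divides the displacement from \<open>b\<close> by the value of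
  \<open>Q\<close> at the new point; contraction and telescoping both rest on this.\<close>

lemma branch_diff:
  assumes "j < d"
  shows "z - b = (B j z - b) * poly Q (B j z)"
  using Q_eq[of "B j z"] poly_branch[OF assms, of z] by simp

text \<open>Otherwise \<open>w = b\<close>, and \<open>b\<close> would be a double preimage of
  itself, shared with the principal branch, against \<open>a \<noteq> 0\<close>.\<close>

lemma branch_neq_fixed:
  assumes "0 < j" "j < d"
  shows "B j w \<noteq> b"
proof
  assume eq: "B j w = b"
  then have "w = b"
    using poly_branch[OF assms(2), of w] fixed by simp
  then have "poly (pderiv P) (B j b) = 0"
    using assms eq B0_fixed by (intro pderiv_eq_0_if_branches_eq[of j 0]) auto
  then show False
    using eq \<open>w = b\<close> norm_a a_def by auto
qed

text \<open>\<open>P\<close> is injective near \<open>b\<close>, and there the preimage is already taken by the principal branch.\<close>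

lemma nonprincipal_branch_far:
  obtains \<delta> where "0 < \<delta>" "\<And>j w. 0 < j \<Longrightarrow> j < d \<Longrightarrow> \<delta> \<le> norm (B j w - b)"
proof -
  have "deriv (poly P) b \<noteq> 0"
    using norm_a by (auto simp: a_def DERIV_imp_deriv[OF poly_DERIV])
  then obtain r where r: "0 < r" "inj_on (poly P) (ball b r)"
    by (rule has_complex_derivative_locally_injective[of "poly P" UNIV b, rotated 3])
      (auto intro: holomorphic_intros)
  have "isCont (poly (pderiv P)) b"
    by simp
  then have "eventually (\<lambda>z. poly (pderiv P) z \<noteq> 0) (at b)"
    using norm_a a_def by (intro tendsto_imp_eventually_ne[of _ a]) (auto simp: isCont_def)
  then have "eventually (\<lambda>z. poly (pderiv P) z \<noteq> 0) (nhds b)"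
    using norm_a a_def by (auto simp: eventually_nhds_conv_at)
  then obtain r' where r': "0 < r'" "\<And>z. dist z b < r' \<Longrightarrow> poly (pderiv P) z \<noteq> 0"
    unfolding eventually_nhds_metric by blast
  have "(poly P \<longlongrightarrow> b) (nhds b)"
    using isCont_def[of b "poly P"] fixed by (simp add: tendsto_nhds_iff)
  moreover have "(B 0 \<longlongrightarrow> b) (nhds b)"
    using B0_isCont B0_fixed by (simp add: tendsto_nhds_iff isCont_def)
  ultimately have "((\<lambda>z. B 0 (poly P z)) \<longlongrightarrow> b) (nhds b)"
    by (rule filterlim_compose[rotated])
  then have "eventually (\<lambda>z. dist (B 0 (poly P z)) b < r) (nhds b)"
    using r(1) by (rule tendstoD)
  then obtain s where s: "0 < s" "\<And>z. dist z b < s \<Longrightarrow> dist (B 0 (poly P z)) b < r"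
    unfolding eventually_nhds_metric by blast
  \<comment> \<open>The three radii ensure, in turn, injectivity of \<open>P\<close>, absence of
    critical points, and that the principal preimage also lies in the disc of injectivity.\<close>
  show thesis
  proof (rule that[of "min r (min r' s)"])
    fix j w assume j: "0 < j" "j < d"
    show "min r (min r' s) \<le> norm (B j w - b)"
    proof (rule ccontr)
      assume "\<not> ?thesis"
      then have near: "dist (B j w) b < r" "dist (B j w) b < r'" "dist (B j w) b < s"
        by (auto simp: dist_norm)
      have "dist (B 0 w) b < r"
        using s(2)[OF near(3)] poly_branch[OF j(2)] by simp
      then have "B j w = B 0 w"
        using inj_onD[OF r(2), of "B j w" "B 0 w"] near(1) poly_branch[of 0 w]
          poly_branch[OF j(2), of w] d_ge
        by (auto simp: dist_commute)
      \<comment> \<open>Coinciding branches would make \<open>B j w\<close> a critical point inside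
        the disc of radius \<open>r'\<close>.\<close>
      then show False
        using pderiv_eq_0_if_branches_eq[of j 0 w] j r'(2)[OF near(2)] by auto
    qed
  qed (use r r' s in auto)
qed

text \<open>Dividing \<open>Q - [:a:]\<close> by the linear factor leaves a polynomial, which is
  bounded on the compact unit disc around \<open>b\<close>.\<close>

lemma Q_lipschitz_at_b:
  obtains K where "0 < K" "\<And>z. norm (z - b) \<le> 1 \<Longrightarrow> norm (poly Q z - a) \<le> K * norm (z - b)"
proof -
  define R where "R = (Q - [:a:]) div [:- b, 1:]"
  have R: "poly Q z - a = (z - b) * poly R z" for z
  proof -
    have "poly ([:- b, 1:] * R) z = poly (Q - [:a:]) z"
      unfolding R_def using linear_factor_mult_div[OF Q_at_b] by simp
    then show ?thesis
      by (simp add: algebra_simps)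
  qed
  have "bounded (poly R ` cball b 1)"
    by (intro compact_imp_bounded compact_continuous_image continuous_intros) auto
  then obtain K where K: "0 < K" "\<And>z. z \<in> cball b 1 \<Longrightarrow> norm (poly R z) \<le> K"
    unfolding bounded_pos by blast
  show thesis
  proof (rule that[OF K(1)])
    fix z assume "norm (z - b) \<le> 1"
    then have "norm (poly R z) \<le> K"
      by (intro K(2)) (simp add: dist_norm norm_minus_commute)
    then show "norm (poly Q z - a) \<le> K * norm (z - b)"
      unfolding R norm_mult by (subst mult.commute) (intro mult_right_mono, auto)
  qed
qed

text \<open>By continuity \<open>poly Q (B 0 z)\<close> is close to \<open>a\<close>, so its modulus
  exceeds any chosen \<open>q\<close> below \<open>norm a\<close>; \<open>branch_diff\<close> turns
  this into contraction.\<close>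

lemma B0_contracts_near_b:
  obtains q r where "1 < q" "0 < r" "r \<le> 1"
    "\<And>z. norm (z - b) < r \<Longrightarrow> q \<le> norm (poly Q (B 0 z)) \<and> norm (B 0 z - b) \<le> norm (z - b) / q"
proof -
  define q where "q = (1 + norm a) / 2"
  have q: "1 < q" "q < norm a"
    using norm_a by (auto simp: q_def)
  have "(B 0 \<longlongrightarrow> b) (nhds b)"
    using B0_isCont B0_fixed by (simp add: tendsto_nhds_iff isCont_def)
  moreover have "(poly Q \<longlongrightarrow> a) (nhds b)"
    using isCont_def[of b "poly Q"] Q_at_b by (simp add: tendsto_nhds_iff)
  ultimately have "((\<lambda>z. poly Q (B 0 z)) \<longlongrightarrow> a) (nhds b)"
    by (rule filterlim_compose[rotated])
  then have "eventually (\<lambda>z. q < norm (poly Q (B 0 z))) (nhds b)"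
    using q(2) by (intro order_tendstoD(1)[OF tendsto_norm])
  then obtain r where r: "0 < r" "\<And>z. dist z b < r \<Longrightarrow> q < norm (poly Q (B 0 z))"
    unfolding eventually_nhds_metric by blast
  show thesis
  proof (rule that[of q "min r 1"])
    fix z assume "norm (z - b) < min r 1"
    then have le: "q \<le> norm (poly Q (B 0 z))"
      using r(2)[of z] by (simp add: dist_norm)
    have "norm (B 0 z - b) * q \<le> norm (B 0 z - b) * norm (poly Q (B 0 z))"
      using le by (intro mult_left_mono) auto
    also have "\<dots> = norm (z - b)"
      using branch_diff[of 0 z] d_ge by (simp add: norm_mult)
    finally have "norm (B 0 z - b) \<le> norm (z - b) / q"
      using q by (simp add: field_simps)
    with le show "q \<le> norm (poly Q (B 0 z)) \<and> norm (B 0 z - b) \<le> norm (z - b) / q"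
      by simp
  qed (use q r in auto)
qed

text \<open>The value \<open>l\<close> is the Koenigs linearising coordinate of \<open>u\<close>. A
  relation, unlike \<open>lim\<close>, carries the existence of the limit with it.\<close>

definition koenigs_lim :: "complex \<Rightarrow> complex \<Rightarrow> bool" where
  "koenigs_lim u l \<longleftrightarrow> (\<lambda>n. a ^ n * ((B 0 ^^ n) u - b)) \<longlonglongrightarrow> l"

text \<open>The functional equation of the Koenigs coordinate; it transports existence of the limit
  from a small disc to points whose orbit enters it.\<close>

lemma koenigs_lim_funpow:
  assumes "koenigs_lim ((B 0 ^^ m) u) l"
  shows "koenigs_lim u (a ^ m * l)"
proof -
  have "(\<lambda>n. a ^ m * (a ^ n * ((B 0 ^^ n) ((B 0 ^^ m) u) - b))) \<longlonglongrightarrow> a ^ m * l"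
    using assms unfolding koenigs_lim_def by (rule tendsto_mult_left)
  then have "(\<lambda>n. a ^ (n + m) * ((B 0 ^^ (n + m)) u - b)) \<longlonglongrightarrow> a ^ m * l"
    by (simp add: funpow_add power_add mult_ac)
  then show ?thesis
    unfolding koenigs_lim_def by (rule LIMSEQ_offset)
qed

text \<open>The rescaled displacement is \<open>u - b\<close> times a product of ratios
  \<open>a / Q\<close>. These approach 1 geometrically, and on a small disc their total deviation is
  at most 1/2, which keeps the product away from 0.\<close>

lemma koenigs_lim_near_b:
  obtains r where "0 < r" "\<And>u. norm (u - b) < r \<Longrightarrow> \<exists>l. koenigs_lim u l \<and> norm (u - b) / 2 \<le> norm l"
proof -
  obtain q s where q: "1 < q" and s: "0 < s" "s \<le> 1"
    and contr: "\<And>z. norm (z - b) < s \<Longrightarrow>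
      q \<le> norm (poly Q (B 0 z)) \<and> norm (B 0 z - b) \<le> norm (z - b) / q"
    by (rule B0_contracts_near_b) blast
  obtain K where K: "0 < K" and lip: "\<And>z. norm (z - b) \<le> 1 \<Longrightarrow> norm (poly Q z - a) \<le> K * norm (z - b)"
    by (rule Q_lipschitz_at_b) blast
  \<comment> \<open>The second bound makes \<open>K * r\<close> times the geometric sum
    \<open>1 / (1 - 1 / q)\<close> at most 1/2.\<close>
  define r where "r = min s ((1 - 1 / q) / (2 * K))"
  have q': "0 < 1 - 1 / q" "norm (1 / q) < 1"
    using q by auto
  have r: "0 < r" "r \<le> s"
    using s K q' by (auto simp: r_def)
  have "r \<le> (1 - 1 / q) / (2 * K)"
    by (simp add: r_def)
  then have Kr: "K * r \<le> (1 - 1 / q) / 2"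
    using K by (simp add: field_simps)
  show thesis
  proof (rule that[OF r(1)])
    fix u assume u: "norm (u - b) < r"
    define v where "v n = (B 0 ^^ n) u" for n
    \<comment> \<open>The second conjunct keeps the orbit in the disc where the contraction
      applies.\<close>
    have v_le: "norm (v n - b) \<le> r * (1 / q) ^ n \<and> norm (v n - b) < r" for n
    proof (induction n)
      case (Suc n)
      have "norm (v (Suc n) - b) \<le> norm (v n - b) / q"
        using contr[of "v n"] Suc r by (simp add: v_def)
      moreover have "norm (v n - b) / q \<le> r * (1 / q) ^ n / q"
        using Suc q by (intro divide_right_mono) auto
      moreover have "norm (v n - b) / q \<le> norm (v n - b)"
        using q mult_left_mono[of 1 q "norm (v n - b)"] by (simp add: field_simps)
      ultimately show ?case
        using Suc by simp
    qed (use u in \<open>simp add: v_def\<close>)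
    define \<rho> where "\<rho> n = a / poly Q (v (Suc n))" for n
    have Q_ge: "q \<le> norm (poly Q (v (Suc n)))" for n
      using contr[of "v n"] v_le[of n] r by (simp add: v_def)
    have \<rho>_le: "norm (\<rho> n - 1) \<le> K * r * (1 / q) ^ n" for n
    proof -
      have Q0: "poly Q (v (Suc n)) \<noteq> 0"
        using Q_ge[of n] q by auto
      have "norm (\<rho> n - 1) = norm (poly Q (v (Suc n)) - a) / norm (poly Q (v (Suc n)))"
        using Q0 by (simp add: \<rho>_def norm_divide[symmetric] divide_diff_eq_iff norm_minus_commute)
      also have "\<dots> \<le> norm (poly Q (v (Suc n)) - a) / 1"
        using Q_ge[of n] q by (intro divide_left_mono) auto
      also have "\<dots> \<le> K * norm (v (Suc n) - b)"
        using lip[of "v (Suc n)"] v_le[of "Suc n"] r s by simp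
      also have "\<dots> \<le> K * (r * (1 / q) ^ n)"
      proof (intro mult_left_mono)
        have "r * (1 / q) ^ Suc n \<le> r * (1 / q) ^ n"
          using q r by (intro mult_left_mono power_decreasing) auto
        then show "norm (v (Suc n) - b) \<le> r * (1 / q) ^ n"
          using v_le[of "Suc n"] by linarith
      qed (use K in auto)
      finally show ?thesis
        by simp
    qed
    have summ: "summable (\<lambda>n. K * r * (1 / q) ^ n)"
      using q' by (intro summable_mult summable_geometric)
    have suminf: "(\<Sum>n. K * r * (1 / q) ^ n) \<le> 1 / 2"
      using q' Kr by (subst suminf_mult) (auto simp: suminf_geometric summable_geometric divide_simps)
    have "summable (\<lambda>n. norm (\<rho> n - 1))"
      using \<rho>_le summ by (intro summable_comparison_test'[OF summ]) auto
    then have "abs_convergent_prod \<rho>"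
      by (simp add: abs_convergent_prod_conv_summable)
    then have "convergent_prod \<rho>"
      by (rule abs_convergent_prod_imp_convergent_prod)
    then obtain p where p: "(\<lambda>n. \<Prod>i\<le>n. \<rho> i) \<longlonglongrightarrow> p"
      using convergent_prod_imp_convergent convergent_def by blast
    have sum_le: "(\<Sum>i\<in>F. norm (\<rho> i - 1)) \<le> 1 / 2" if "finite F" for F
    proof -
      have "(\<Sum>i\<in>F. norm (\<rho> i - 1)) \<le> (\<Sum>i\<in>F. K * r * (1 / q) ^ i)"
        by (intro sum_mono \<rho>_le)
      also have "\<dots> \<le> (\<Sum>i. K * r * (1 / q) ^ i)"
        using K r q that by (intro sum_le_suminf summ) auto
      finally show ?thesis
        using suminf by linarith
    qed
    have "1 / 2 \<le> norm (\<Prod>i\<le>n. \<rho> i)" for n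
    proof -
      \<comment> \<open>Weierstrass' inequality bounds a product of terms \<open>1 - x\<close> below
        by 1 minus the sum of the \<open>x\<close>.\<close>
      have "1 / 2 \<le> 1 - (\<Sum>i\<le>n. norm (\<rho> i - 1))"
        using sum_le[of "{..n}"] by simp
      also have "\<dots> \<le> (\<Prod>i\<le>n. 1 - norm (\<rho> i - 1))"
      proof (rule Weierstrass_prod_ineq)
        fix i
        show "norm (\<rho> i - 1) \<in> {0..1}"
          using sum_le[of "{i}"] by simp
      qed
      also have "\<dots> \<le> (\<Prod>i\<le>n. norm (\<rho> i))"
      proof (rule prod_mono)
        fix i
        have "norm (\<rho> i - 1) \<le> 1 / 2"
          using sum_le[of "{i}"] by simp
        moreover have "1 - norm (\<rho> i - 1) \<le> norm (\<rho> i)"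
          using norm_triangle_ineq2[of 1 "1 - \<rho> i"] by (simp add: norm_minus_commute)
        ultimately show "0 \<le> 1 - norm (\<rho> i - 1) \<and> 1 - norm (\<rho> i - 1) \<le> norm (\<rho> i)"
          by simp
      qed
      finally show ?thesis
        by (simp add: prod_norm)
    qed
    then have p_ge: "1 / 2 \<le> norm p"
      by (intro tendsto_lowerbound[OF tendsto_norm[OF p]]) auto
    have partial: "a ^ n * (v n - b) = (u - b) * (\<Prod>i<n. \<rho> i)" for n
    proof (induction n)
      case (Suc n)
      have "v n - b = (v (Suc n) - b) * poly Q (v (Suc n))"
        using branch_diff[of 0 "v n"] d_ge by (simp add: v_def)
      moreover have "poly Q (v (Suc n)) \<noteq> 0"
        using Q_ge[of n] q by auto
      ultimately have "a ^ Suc n * (v (Suc n) - b) = a ^ n * (v n - b) * \<rho> n"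
        by (simp add: \<rho>_def)
      then show ?case
        using Suc by simp
    qed (simp add: v_def)
    have "(\<lambda>n. \<Prod>i<n. \<rho> i) \<longlonglongrightarrow> p"
      using p by (subst filterlim_sequentially_Suc[symmetric]) (simp add: lessThan_Suc_atMost)
    then have "koenigs_lim u ((u - b) * p)"
      unfolding koenigs_lim_def v_def[symmetric] partial by (rule tendsto_mult_left)
    moreover have "norm (u - b) / 2 \<le> norm ((u - b) * p)"
      using mult_left_mono[OF p_ge, of "norm (u - b)"] by (simp add: norm_mult)
    ultimately show "\<exists>l. koenigs_lim u l \<and> norm (u - b) / 2 \<le> norm l"
      by blast
  qed
qed

text \<open>Just before first entering the small disc, the orbit is at distance at least \<open>\<rho>\<close> from \<open>b\<close>,
  and one step of \<open>B 0\<close> contracts this distance at most by the factor \<open>sup |Q|\<close> over the disc.\<close>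

lemma koenigs_lim_bounded_below:
  assumes "0 < \<delta>"
  obtains C where "0 < C"
    "\<And>u. \<exists>l. koenigs_lim u l \<and> (\<delta> \<le> norm (u - b) \<longrightarrow> C \<le> norm l)"
proof -
  obtain r where r: "0 < r"
    and near: "\<And>u. norm (u - b) < r \<Longrightarrow> \<exists>l. koenigs_lim u l \<and> norm (u - b) / 2 \<le> norm l"
    by (rule koenigs_lim_near_b) blast
  \<comment> \<open>Being at most \<open>r\<close> gives the local estimate on the disc; being at
    most \<open>\<delta>\<close> makes far starting points lie outside it, so that a step before
    entry exists.\<close>
  define \<rho> where "\<rho> = min r \<delta>"
  have \<rho>: "0 < \<rho>" "\<rho> \<le> r" "\<rho> \<le> \<delta>"
    using r assms by (auto simp: \<rho>_def)
  have "bounded (poly Q ` cball b r)"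
    by (intro compact_imp_bounded compact_continuous_image continuous_intros) auto
  then obtain M where M: "0 < M" "\<And>z. z \<in> cball b r \<Longrightarrow> norm (poly Q z) \<le> M"
    unfolding bounded_pos by blast
  show thesis
  proof (rule that[of "\<rho> / (2 * M)"])
    fix u
    have "eventually (\<lambda>n. dist ((B 0 ^^ n) u) b < \<rho>) sequentially"
      using B0_iterates \<rho>(1) by (rule tendstoD)
    then obtain N where "norm ((B 0 ^^ N) u - b) < \<rho>"
      unfolding eventually_sequentially dist_norm by blast
    define n where "n = (LEAST n. norm ((B 0 ^^ n) u - b) < \<rho>)"
    define v where "v = (B 0 ^^ n) u"
    have v: "norm (v - b) < \<rho>"
      unfolding v_def n_def by (rule LeastI) fact
    then obtain l where l: "koenigs_lim v l" "norm (v - b) / 2 \<le> norm l"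
      using near[of v] \<rho> by auto
    have "\<rho> / (2 * M) \<le> norm (a ^ n * l)" if far: "\<delta> \<le> norm (u - b)"
    proof -
      have "n \<noteq> 0"
        using v far \<rho> by (cases n) (auto simp: v_def)
      then obtain m where m: "n = Suc m"
        using not0_implies_Suc by blast
      have "\<rho> \<le> norm ((B 0 ^^ m) u - b)"
        using not_less_Least[of m "\<lambda>n. norm ((B 0 ^^ n) u - b) < \<rho>"] m n_def by simp
      also have "\<dots> = norm (v - b) * norm (poly Q v)"
        using branch_diff[of 0 "(B 0 ^^ m) u"] d_ge by (simp add: v_def m norm_mult[symmetric])
      also have "\<dots> \<le> norm (v - b) * M"
        using v \<rho> by (intro mult_left_mono M) (auto simp: dist_norm norm_minus_commute)
      finally have "\<rho> / (2 * M) \<le> norm (v - b) / 2"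
        using M(1) by (simp add: field_simps)
      also have "\<dots> \<le> norm l"
        by fact
      \<comment> \<open>The entry time \<open>n\<close> is not bounded in \<open>u\<close>, but
        since \<open>norm a > 1\<close> the factor \<open>a ^ n\<close> only helps.\<close>
      also have "\<dots> \<le> norm a ^ n * norm l"
        using norm_a one_le_power[of "norm a" n] mult_right_mono[of 1 "norm a ^ n" "norm l"] by simp
      finally show ?thesis
        by (simp add: norm_mult norm_power)
    qed
    moreover have "koenigs_lim u (a ^ n * l)"
      using l(1) unfolding v_def by (rule koenigs_lim_funpow)
    ultimately show "\<exists>l. koenigs_lim u l \<and> (\<delta> \<le> norm (u - b) \<longrightarrow> \<rho> / (2 * M) \<le> norm l)"
      by blast
  qed (use \<rho> M in auto)
qed

section \<open>The functions \<open>g\<close> as limits along backward orbits\<close>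

lemma branch_comp_Suc:
  assumes "k \<le> Suc n"
  shows "branch_comp B \<sigma> k (Suc n) w = B (\<sigma> (Suc n)) (branch_comp B \<sigma> k n w)"
  using assms by (simp add: branch_comp_def)

text \<open>Since \<open>Q(z\<^sub>n) = (z\<^sub>n\<^sub>-\<^sub>1 - b) / (z\<^sub>n - b)\<close> along a backward orbit, the partial products telescope.\<close>

lemma prod_branch_comp:
  assumes \<sigma>: "\<And>n. \<sigma> n < d" and nz: "branch_comp B \<sigma> k m w \<noteq> b" and "k \<le> Suc m" "m \<le> M"
  shows "a ^ m * (branch_comp B \<sigma> k m w - b) * (\<Prod>n=m+1..M. a / poly Q (branch_comp B \<sigma> k n w))
      = a ^ M * (branch_comp B \<sigma> k M w - b) \<and> branch_comp B \<sigma> k M w \<noteq> b"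
  using \<open>m \<le> M\<close>
proof (induction M rule: dec_induct)
  case (step M)
  let ?z = "branch_comp B \<sigma> k M w" and ?z' = "branch_comp B \<sigma> k (Suc M) w"
  have eq: "?z - b = (?z' - b) * poly Q ?z'"
    using branch_diff[OF \<sigma>[of "Suc M"], of ?z] step.hyps \<open>k \<le> Suc m\<close> by (simp add: branch_comp_Suc)
  \<comment> \<open>If either factor vanished, the previous point would equal
    \<open>b\<close>.\<close>
  then have nz': "?z' \<noteq> b" "poly Q ?z' \<noteq> 0"
    using step.IH by auto
  have "a ^ m * (branch_comp B \<sigma> k m w - b) * (\<Prod>n=m+1..Suc M. a / poly Q (branch_comp B \<sigma> k n w))
      = a ^ M * (?z - b) * (a / poly Q ?z')"
    using step.IH step.hyps by (simp add: mult.assoc[symmetric])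
  also have "\<dots> = a ^ Suc M * (?z' - b)"
    unfolding eq using nz' by simp
  finally show ?case
    using nz' by simp
qed (use nz in simp)

text \<open>Both cases in the definition of \<open>g\<close> are the same limit: telescoping starts
  at \<open>m = 0\<close> when \<open>w \<noteq> b\<close>, and at the first nonzero index when
  \<open>w = b\<close>.\<close>

lemma g_eqI:
  assumes \<sigma>: "\<sigma> \<in> ev_zero_seqs d" "\<sigma> \<noteq> (\<lambda>_. 0)"
    and lim: "(\<lambda>M. a ^ M * (branch_comp B \<sigma> 1 M w - b)) \<longlonglongrightarrow> l"
  shows "g P b B \<sigma> w = l"
proof -
  have less: "\<sigma> n < d" for n
    using ev_zero_seqs_less[OF \<sigma>(1)] d_ge by simp
  \<comment> \<open>Shared by both cases: agreement from some index on identifies the value of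
    \<open>lim\<close>.\<close>
  have lim_eq: "c * lim X = l"
    if "c \<noteq> 0" and ev: "\<And>M. m \<le> M \<Longrightarrow> c * X M = a ^ M * (branch_comp B \<sigma> 1 M w - b)"
    for c X and m :: nat
  proof -
    have "(\<lambda>M. a ^ M * (branch_comp B \<sigma> 1 M w - b) / c) \<longlonglongrightarrow> l / c"
      using lim \<open>c \<noteq> 0\<close> by (intro tendsto_divide) auto
    moreover have "eventually (\<lambda>M. a ^ M * (branch_comp B \<sigma> 1 M w - b) / c = X M) sequentially"
      using eventually_ge_at_top[of m] by eventually_elim (use ev \<open>c \<noteq> 0\<close> in \<open>simp add: field_simps\<close>)
    ultimately have "X \<longlonglongrightarrow> l / c"
      by (rule Lim_transform_eventually)
    then show ?thesis
      using \<open>c \<noteq> 0\<close> by (simp add: limI)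
  qed
  show ?thesis
  proof (cases "w = b")
    case False
    have "(w - b) * lim (\<lambda>M. \<Prod>n=1..M. a / poly Q (branch_comp B \<sigma> 1 n w)) = l"
    proof (rule lim_eq)
      fix M :: nat
      show "(w - b) * (\<Prod>n=1..M. a / poly Q (branch_comp B \<sigma> 1 n w)) = a ^ M * (branch_comp B \<sigma> 1 M w - b)"
        using prod_branch_comp[of \<sigma> 1 0 w M, OF less] False by (simp add: branch_comp_def)
    qed (use False in auto)
    then show ?thesis
      using False by (simp add: g_def Let_def a_def)
  next
    case True
    define k where "k = (LEAST n. \<sigma> n \<noteq> 0)"
    have "\<exists>n. \<sigma> n \<noteq> 0"
      using \<sigma>(2) by auto
    then have k: "\<sigma> k \<noteq> 0"
      unfolding k_def by (rule LeastI_ex)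
    have before: "\<sigma> n = 0" if "n < k" for n
      using not_less_Least that unfolding k_def by blast
    have "0 < k"
      using k \<sigma>(1) by (metis (mono_tags, lifting) ev_zero_seqs_def mem_Collect_eq gr0I)
    have stay: "branch_comp B \<sigma> 1 n b = b" if "n < k" for n
      using that
    proof (induction n)
      case (Suc n)
      then show ?case
        using before B0_fixed by (simp add: branch_comp_Suc)
    qed (simp add: branch_comp_def)
    have at_k: "branch_comp B \<sigma> k k b = B (\<sigma> k) b"
      by (simp add: branch_comp_def)
    \<comment> \<open>The leading principal branches fix \<open>b\<close>, so composing from index 1
      or from \<open>k\<close> gives the same point.\<close>
    have same: "branch_comp B \<sigma> k n b = branch_comp B \<sigma> 1 n b" if "k \<le> n" for n
      using that
    proof (induction n rule: dec_induct)
      case base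
      then show ?case
        using stay[of "k - 1"] \<open>0 < k\<close> at_k branch_comp_Suc[of 1 "k - 1" \<sigma> b] by simp
    qed (simp add: branch_comp_Suc \<open>0 < k\<close> Suc_leI)
    have nz: "B (\<sigma> k) b \<noteq> b"
      using k less by (intro branch_neq_fixed) auto
    have "a ^ k * (B (\<sigma> k) b - b) * lim (\<lambda>M. \<Prod>n=k+1..M. a / poly Q (branch_comp B \<sigma> k n b)) = l"
    proof (rule lim_eq)
      fix M assume "k \<le> M"
      then show "a ^ k * (B (\<sigma> k) b - b) * (\<Prod>n=k+1..M. a / poly Q (branch_comp B \<sigma> k n b))
          = a ^ M * (branch_comp B \<sigma> 1 M w - b)"
        using prod_branch_comp[of \<sigma> k k b M, OF less] nz same[of M] at_k True by simp
    qed (use nz norm_a in auto)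
    then show ?thesis
      using True \<sigma>(2) by (simp add: g_def Let_def a_def k_def)
  qed
qed

text \<open>Step \<open>L\<close> puts the orbit at distance at least \<open>\<delta>\<close> from
  \<open>b\<close>, and afterwards only \<open>B 0\<close> acts. Both \<open>\<delta>\<close> and
  \<open>C\<close> are fixed before \<open>w\<close> and \<open>\<sigma>\<close>, whence the
  uniformity.\<close>

lemma g_bounded_below:
  obtains C where "0 < C"
    "\<And>w \<sigma>. \<sigma> \<in> ev_zero_seqs d \<Longrightarrow> \<sigma> \<noteq> (\<lambda>_. 0) \<Longrightarrow> C * norm a ^ supp_len \<sigma> \<le> norm (g P b B \<sigma> w)"
proof -
  obtain \<delta> where \<delta>: "0 < \<delta>" "\<And>j w. 0 < j \<Longrightarrow> j < d \<Longrightarrow> \<delta> \<le> norm (B j w - b)"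
    by (rule nonprincipal_branch_far) blast
  obtain C where C: "0 < C"
    "\<And>u. \<exists>l. koenigs_lim u l \<and> (\<delta> \<le> norm (u - b) \<longrightarrow> C \<le> norm l)"
    by (rule koenigs_lim_bounded_below[OF \<delta>(1)]) blast
  show thesis
  proof (rule that[OF C(1)])
    fix w and \<sigma> :: "nat \<Rightarrow> nat" assume \<sigma>: "\<sigma> \<in> ev_zero_seqs d" "\<sigma> \<noteq> (\<lambda>_. 0)"
    define L where "L = supp_len \<sigma>"
    define u where "u = branch_comp B \<sigma> 1 L w"
    have L: "\<sigma> L \<noteq> 0" "0 < L"
      using supp_len_nonzero[OF \<sigma>] by (auto simp: L_def)
    have "\<sigma> L < d"
      using ev_zero_seqs_less[OF \<sigma>(1)] d_ge by simp
    moreover have "u = B (\<sigma> L) (branch_comp B \<sigma> 1 (L - 1) w)"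
      using branch_comp_Suc[of 1 "L - 1" \<sigma> w] L(2) by (simp add: u_def)
    ultimately have far: "\<delta> \<le> norm (u - b)"
      using L(1) \<delta>(2) by simp
    have tail: "branch_comp B \<sigma> 1 (n + L) w = (B 0 ^^ n) u" for n
      by (induction n) (auto simp: u_def branch_comp_Suc eq_zero_beyond_supp_len[OF \<sigma>(1)] L_def)
    obtain l where l: "koenigs_lim u l" "C \<le> norm l"
      using C(2)[of u] far by blast
    have "(\<lambda>n. a ^ L * (a ^ n * ((B 0 ^^ n) u - b))) \<longlonglongrightarrow> a ^ L * l"
      using l(1) unfolding koenigs_lim_def by (rule tendsto_mult_left)
    then have "(\<lambda>n. a ^ (n + L) * (branch_comp B \<sigma> 1 (n + L) w - b)) \<longlonglongrightarrow> a ^ L * l"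
      unfolding tail by (simp add: power_add mult_ac)
    then have "g P b B \<sigma> w = a ^ L * l"
      by (intro g_eqI \<sigma>) (rule LIMSEQ_offset)
    then show "C * norm a ^ supp_len \<sigma> \<le> norm (g P b B \<sigma> w)"
      using l(2) norm_a mult_right_mono[of C "norm l" "norm a ^ L"]
      by (simp add: norm_mult norm_power L_def mult.commute)
  qed
qed

section \<open>Tail asymptotics of the sum and the product\<close>

lemma sum_and_prod_asymptotics:
  assumes C: "0 < C"
    and g_ge: "\<And>\<sigma>. \<sigma> \<in> ev_zero_seqs d \<Longrightarrow> \<sigma> \<noteq> (\<lambda>_. 0) \<Longrightarrow> C * norm a ^ supp_len \<sigma> \<le> norm (g P b B \<sigma> w)"
    and da: "real d < norm a"
  shows "1 \<le> m \<Longrightarrow> (\<lambda>\<sigma>. 1 / norm (g P b B \<sigma> w) ^ m) summable_on seqs_supp_ge d N" (is "_ \<Longrightarrow> ?summ m N")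
    and "1 \<le> m \<Longrightarrow> (\<lambda>N. \<Sum>\<^sub>\<infinity>\<sigma>\<in>seqs_supp_ge d N. 1 / norm (g P b B \<sigma> w) ^ m)
        \<in> O(\<lambda>N. (real d / norm a ^ m) ^ N)"
    and "\<exists>p. has_unordered_prod (\<lambda>\<sigma>. norm (1 - z / g P b B \<sigma> w)) p (seqs_supp_ge d N)"
    and "\<exists>K. \<forall>z. \<forall>\<^sub>F N in sequentially.
        \<bar>unordered_prod (\<lambda>\<sigma>. norm (1 - z / g P b B \<sigma> w)) (seqs_supp_ge d N) - 1\<bar>
          \<le> K * (norm z * (real d / norm a) ^ N)"
proof -
  let ?f = "\<lambda>m \<sigma>. 1 / norm (g P b B \<sigma> w) ^ m"
  \<comment> \<open>The geometric bound with ratio parameter \<open>1 / norm a ^ m\<close> and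
    prefactor \<open>(1 / C) ^ m\<close>.\<close>
  define D where "D m = (1 / C) ^ m / (1 - real d / norm a ^ m)" for m
  have d_pos: "0 < d"
    using d_ge by simp
  have ratio: "real d * (1 / norm a ^ m) < 1" if "1 \<le> m" for m
    using da norm_a self_le_power[of "norm a" m] that by (auto simp: divide_simps)
  have f_le: "?f m \<sigma> \<le> (1 / C) ^ m * (1 / norm a ^ m) ^ supp_len \<sigma>" if "\<sigma> \<in> seqs_supp_ge d N" for m \<sigma> N
  proof -
    have pos: "0 < C * norm a ^ supp_len \<sigma>"
      using C norm_a by (intro mult_pos_pos zero_less_power) auto
    have ge: "C * norm a ^ supp_len \<sigma> \<le> norm (g P b B \<sigma> w)"
      using that g_ge by (auto simp: seqs_supp_ge_def)
    have "?f m \<sigma> \<le> 1 / (C * norm a ^ supp_len \<sigma>) ^ m"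
      using pos ge by (intro frac_le power_mono zero_less_power[OF pos]) auto
    also have "\<dots> = (1 / C) ^ m * (1 / norm a ^ m) ^ supp_len \<sigma>"
      by (simp add: power_mult_distrib power_one_over power_mult[symmetric] mult.commute)
    finally show ?thesis .
  qed
  have f: "?f m summable_on seqs_supp_ge d N"
      "(\<Sum>\<^sub>\<infinity>\<sigma>\<in>seqs_supp_ge d N. ?f m \<sigma>) \<le> D m * (real d / norm a ^ m) ^ N"
    if "1 \<le> m" for m N
    using summable_on_geometric_supp_len[OF d_pos _ ratio[OF that], of "(1 / C) ^ m" N "?f m"] C f_le
    by (auto simp: D_def)
  show "?summ m N" if "1 \<le> m"
    using f that by blast
  show "(\<lambda>N. \<Sum>\<^sub>\<infinity>\<sigma>\<in>seqs_supp_ge d N. ?f m \<sigma>) \<in> O(\<lambda>N. (real d / norm a ^ m) ^ N)" if "1 \<le> m"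
    using f(2)[OF that] by (intro bigoI[of _ "D m"]) (auto simp: infsum_nonneg)
  define h where "h z \<sigma> = norm (1 - z / g P b B \<sigma> w)" for z \<sigma>
  \<comment> \<open>The reverse triangle inequality reduces the product to the sum with
    \<open>m = 1\<close>.\<close>
  have h_le: "\<bar>h z \<sigma> - 1\<bar> \<le> norm z * ?f 1 \<sigma>" for z \<sigma>
    using norm_triangle_ineq3[of "1 - z / g P b B \<sigma> w" 1] by (simp add: h_def norm_divide)
  have h_summ: "(\<lambda>\<sigma>. \<bar>h z \<sigma> - 1\<bar>) summable_on seqs_supp_ge d N" for z N
    by (rule summable_on_comparison_test[OF summable_on_cmult_right[OF f(1)[of 1]]]) (use h_le in auto)
  have h_sum: "(\<Sum>\<^sub>\<infinity>\<sigma>\<in>seqs_supp_ge d N. \<bar>h z \<sigma> - 1\<bar>) \<le> D 1 * (norm z * (real d / norm a) ^ N)" for z N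
  proof -
    have "(\<Sum>\<^sub>\<infinity>\<sigma>\<in>seqs_supp_ge d N. \<bar>h z \<sigma> - 1\<bar>) \<le> (\<Sum>\<^sub>\<infinity>\<sigma>\<in>seqs_supp_ge d N. norm z * ?f 1 \<sigma>)"
      using f(1)[of 1] h_le by (intro infsum_mono h_summ summable_on_cmult_right) auto
    also have "\<dots> = norm z * (\<Sum>\<^sub>\<infinity>\<sigma>\<in>seqs_supp_ge d N. ?f 1 \<sigma>)"
      using f(1)[of 1] by (intro infsum_cmult_right) auto
    also have "\<dots> \<le> norm z * (D 1 * (real d / norm a) ^ N)"
      using f(2)[of 1 N] by (intro mult_left_mono) auto
    finally show ?thesis
      by (simp add: mult_ac)
  qed
  show "\<exists>p. has_unordered_prod (\<lambda>\<sigma>. norm (1 - z / g P b B \<sigma> w)) p (seqs_supp_ge d N)"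
    using has_unordered_prod_exists[OF h_summ[of z N]] by (simp add: h_def)
  \<comment> \<open>The constant \<open>2 * D 1\<close> is independent of \<open>z\<close>; only the
    threshold for \<open>N\<close> depends on \<open>z\<close>, as the tail sum must be at most 1
    for the product estimate.\<close>
  have "\<forall>\<^sub>F N in sequentially. \<bar>unordered_prod (h z) (seqs_supp_ge d N) - 1\<bar>
      \<le> (2 * D 1) * (norm z * (real d / norm a) ^ N)" for z
  proof -
    have "norm (real d / norm a) < 1"
      using ratio[of 1] by simp
    then have "(\<lambda>N. D 1 * (norm z * (real d / norm a) ^ N)) \<longlonglongrightarrow> D 1 * (norm z * 0)"
      by (intro tendsto_mult_left LIMSEQ_power_zero)
    then have "\<forall>\<^sub>F N in sequentially. D 1 * (norm z * (real d / norm a) ^ N) < 1"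
      by (rule order_tendstoD(2)) simp
    then show ?thesis
    proof eventually_elim
      case (elim N)
      then have "\<bar>unordered_prod (h z) (seqs_supp_ge d N) - 1\<bar> \<le> 2 * (D 1 * (norm z * (real d / norm a) ^ N))"
        by (intro abs_unordered_prod_minus_one_le h_summ h_sum) (auto simp: h_def)
      then show ?case
        by (simp only: mult.assoc)
    qed
  qed
  then show "\<exists>K. \<forall>z. \<forall>\<^sub>F N in sequentially.
        \<bar>unordered_prod (\<lambda>\<sigma>. norm (1 - z / g P b B \<sigma> w)) (seqs_supp_ge d N) - 1\<bar>
          \<le> K * (norm z * (real d / norm a) ^ N)"
    unfolding h_def by blast
qed

end

theorem theorem1p5:
  fixes P :: "complex poly" and b a :: complex and d :: nat
    and B :: "nat \<Rightarrow> complex \<Rightarrow> complex"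
  assumes "d = degree P" and "d \<ge> 2"
    and "b \<noteq> 0" and "poly P b = b"
    and "a = poly (pderiv P) b" and "norm a > 1"
    and "\<And>w. image_mset (\<lambda>j. B j w) (mset_set {0..d - 1}) = proots (P - [:w:])"
    and "B 0 b = b"
    and "\<exists>U. open U \<and> b \<in> U \<and> B 0 analytic_on U"
    and "\<And>w. (\<lambda>n. (B 0 ^^ n) w) \<longlonglongrightarrow> b"
  shows "(\<exists>C>0. \<forall>w. \<forall>\<sigma>\<in>ev_zero_seqs d. \<sigma> \<noteq> (\<lambda>_. 0) \<longrightarrow>
            norm (g P b B \<sigma> w) \<ge> C * norm a ^ supp_len \<sigma>) \<and>
         (real d < norm a \<longrightarrow>
            (\<forall>w.
              (\<forall>m::nat. m \<ge> 1 \<longrightarrow>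
                (\<forall>N. (\<lambda>\<sigma>. 1 / norm (g P b B \<sigma> w) ^ m) summable_on seqs_supp_ge d N) \<and>
                (\<lambda>N. \<Sum>\<^sub>\<infinity>\<sigma>\<in>seqs_supp_ge d N. 1 / norm (g P b B \<sigma> w) ^ m)
                  \<in> O(\<lambda>N. (real d / norm a ^ m) ^ N)) \<and>
              (\<forall>z N. \<exists>p. has_unordered_prod (\<lambda>\<sigma>. norm (1 - z / g P b B \<sigma> w)) p (seqs_supp_ge d N)) \<and>
              (\<exists>K. \<forall>z. \<forall>\<^sub>F N in sequentially.
                \<bar>unordered_prod (\<lambda>\<sigma>. norm (1 - z / g P b B \<sigma> w)) (seqs_supp_ge d N) - 1\<bar>
                  \<le> K * (norm z * (real d / norm a) ^ N))))"
proof -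
  have "isCont (B 0) b"
    using assms(9) analytic_on_analytic_at analytic_at_imp_isCont by blast
  with assms interpret repelling_branches P b a d B
    by unfold_locales auto
  obtain C where C: "0 < C"
    "\<And>w \<sigma>. \<sigma> \<in> ev_zero_seqs d \<Longrightarrow> \<sigma> \<noteq> (\<lambda>_. 0) \<Longrightarrow> C * norm a ^ supp_len \<sigma> \<le> norm (g P b B \<sigma> w)"
    by (rule g_bounded_below) blast
  have g_ge: "C * norm a ^ supp_len \<sigma> \<le> norm (g P b B \<sigma> w)"
    if "\<sigma> \<in> ev_zero_seqs d" "\<sigma> \<noteq> (\<lambda>_. 0)" for w \<sigma>
    using C(2) that .
  show ?thesis
  proof (intro conjI impI allI)
    show "\<exists>C>0. \<forall>w. \<forall>\<sigma>\<in>ev_zero_seqs d. \<sigma> \<noteq> (\<lambda>_. 0) \<longrightarrow>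
        C * norm a ^ supp_len \<sigma> \<le> norm (g P b B \<sigma> w)"
      using C(1) g_ge by blast
  \<comment> \<open>The remaining goals concern one fixed \<open>w\<close> each, and the uniform
    \<open>C\<close> serves them all.\<close>
  qed (rule sum_and_prod_asymptotics[OF C(1) g_ge]; assumption)+
qed

end
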